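(* Let $\tau:[0,1]\to[0,1]$ be a piecewise convex map with countably many branches (in the class described in the context), with partition points $1=a_0>a_1>a_2>\cdots\to0$, and let $\tau_n$, $n=1,2,\dots$, be defined by $\tau_n(x)=x/a_n$ for $0\le x<a_n$ and $\tau_n(x)=\tau(x)$ for $a_n\le x\le1$. Then $\tau_n$ converges to $\tau$ almost uniformly.
   Context: $\lambda$ is Lebesgue measure on $[0,1]$. The map $\tau$: there are points $1=a_0>a_1>a_2>\cdots$ with $\lim_{n\to\infty}a_n=0$ such that $\tau:[0,1]\to[0,1]$ satisfies: (i) for every $j\ge 1$, $\tau|_{[a_j,a_{j-1})}$ is continuous and convex; (ii) $\tau(a_j)=0$ and $\tau'(a_j)>0$ for every $j\ge1$, where $\tau'(a_j)$ is the right derivative; (iii) $\sum_{j\ge 1}\frac{1}{\tau'(a_j)}<\infty$. Almost uniform convergence: maps $\tau_n:[0,1]\to[0,1]$ converge to $\tau$ almost uniformly if for every $\epsilon>0$ there is a measurable set $A_\epsilon\subset[0,1]$ with $\lambda(A_\epsilon)>1-\epsilon$ such that $\tau_n\to\tau$ uniformly on $A_\epsilon$. *)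

theory Defs
  imports "HOL-Analysis.Analysis"
begin

text \<open>Maps of \<open>[0,1]\<close> are total functions on the reals of which only the values on \<open>{0..1}\<close> matter.
  \<open>D j\<close> is the right derivative of \<open>\<tau>\<close> at \<open>a j\<close>; \<open>D 0\<close> is not used, so the series of reciprocals
  is written with a shifted index. The value of \<open>\<tau>\<close> at \<open>0\<close> and at \<open>a 0 = 1\<close> is unconstrained
  within \<open>{0..1}\<close>.\<close>

definition piecewise_convex_map :: "(nat \<Rightarrow> real) \<Rightarrow> (real \<Rightarrow> real) \<Rightarrow> bool" where
  "piecewise_convex_map a \<tau> \<longleftrightarrow>
     a 0 = 1 \<and> (\<forall>j. a (Suc j) < a j) \<and> a \<longlonglongrightarrow> 0 \<and>
     \<tau> \<in> {0..1} \<rightarrow> {0..1} \<and>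
     (\<forall>j\<ge>1. continuous_on {a j..<a (j - 1)} \<tau> \<and> convex_on {a j..<a (j - 1)} \<tau>) \<and>
     (\<forall>j\<ge>1. \<tau> (a j) = 0) \<and>
     (\<exists>D. (\<forall>j\<ge>1. (\<tau> has_real_derivative D j) (at_right (a j)) \<and> D j > 0) \<and>
          summable (\<lambda>j. 1 / D (Suc j)))"

definition almost_uniform_limit :: "(nat \<Rightarrow> real \<Rightarrow> real) \<Rightarrow> (real \<Rightarrow> real) \<Rightarrow> bool" where
  "almost_uniform_limit f g \<longleftrightarrow>
     (\<forall>\<epsilon>>0. \<exists>A \<in> sets (lebesgue_on {0..1}).
        measure (lebesgue_on {0..1}) A > 1 - \<epsilon> \<and> uniform_limit A f g sequentially)"

end

theory Submission
  imports Defs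
begin

text \<open>On \<open>{0..1}\<close>, for n \<ge> 1, the map \<open>\<tau>n n\<close> can differ
  from \<tau> only on the initial interval \<open>{0..<a n}\<close>, and these intervals shrink as
  \<open>a n\<close> decreases to 0. Discarding a single one of length below \<epsilon>, say
  \<open>{0..<a N}\<close>, leaves a set on which all \<open>\<tau>n n\<close> with n \<ge> N
  coincide with \<tau>; convergence there is uniform because the sequence is eventually
  constant.\<close>

theorem lemma7:
  fixes a :: "nat \<Rightarrow> real" and \<tau> :: "real \<Rightarrow> real" and \<tau>n :: "nat \<Rightarrow> real \<Rightarrow> real"
  assumes "piecewise_convex_map a \<tau>"
    and "\<And>n x. n \<ge> 1 \<Longrightarrow> 0 \<le> x \<Longrightarrow> x < a n \<Longrightarrow> \<tau>n n x = x / a n"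
    and "\<And>n x. n \<ge> 1 \<Longrightarrow> a n \<le> x \<Longrightarrow> x \<le> 1 \<Longrightarrow> \<tau>n n x = \<tau> x"
  shows "almost_uniform_limit \<tau>n \<tau>"
  unfolding almost_uniform_limit_def
proof (intro allI impI)
  fix \<epsilon> :: real
  assume "\<epsilon> > 0"
  have a0: "a 0 = 1" and lim: "a \<longlonglongrightarrow> 0" and step: "\<And>j. a (Suc j) < a j"
    using assms(1) by (auto simp: piecewise_convex_map_def)
  have dec: "decseq a"
    using step by (intro decseq_SucI less_imp_le)
  \<comment> \<open>The index must also be at least 1, since \<open>\<tau>n\<close> is prescribed
    only from there on.\<close>
  have "\<forall>\<^sub>F n in sequentially. a n < \<epsilon> \<and> n \<ge> 1"
    using order_tendstoD(2)[OF lim \<open>\<epsilon> > 0\<close>] eventually_ge_at_top[of 1]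
    by (rule eventually_conj)
  then obtain N where N: "a N < \<epsilon>" "N \<ge> 1"
    unfolding eventually_sequentially by blast
  have "0 \<le> a N"
    using decseq_ge[OF dec lim] .
  \<comment> \<open>Keeps \<open>{a N..1}\<close> from being empty, so that its measure is
    \<open>1 - a N\<close>.\<close>
  have "a N \<le> 1"
    using decseqD[OF dec, of 0 N] a0 by simp
  let ?A = "{a N..1}"
  have "?A \<subseteq> {0..1}"
    using \<open>0 \<le> a N\<close> by auto
  then have A: "?A \<in> sets (lebesgue_on {0..1})"
    by (simp add: sets_restrict_space_iff)
  have "measure (lebesgue_on {0..1}) ?A = 1 - a N"
    using \<open>?A \<subseteq> {0..1}\<close> \<open>a N \<le> 1\<close> by (simp add: measure_restrict_space)
  then have large: "measure (lebesgue_on {0..1}) ?A > 1 - \<epsilon>"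
    using N(1) by simp
  \<comment> \<open>Monotonicity gives \<open>a n \<le> a N \<le> x\<close>, so x lies where \<tau>
    was left unchanged.\<close>
  have agree: "\<tau>n n x = \<tau> x" if "n \<ge> N" "x \<in> ?A" for n x
    using assms(3)[of n x] decseqD[OF dec that(1)] that N(2) by simp
  have "uniform_limit ?A \<tau>n \<tau> sequentially"
  proof (rule uniform_limitI)
    fix e :: real
    assume "e > 0"
    \<comment> \<open>From N on the distance is exactly 0, so the same N serves every e and every
      x.\<close>
    show "\<forall>\<^sub>F n in sequentially. \<forall>x\<in>?A. dist (\<tau>n n x) (\<tau> x) < e"
      using eventually_ge_at_top[of N] by eventually_elim (simp add: agree \<open>e > 0\<close>)
  qed
  with A large show "\<exists>A \<in> sets (lebesgue_on {0..1}).
      measure (lebesgue_on {0..1}) A > 1 - \<epsilon> \<and> uniform_limit A \<tau>n \<tau> sequentially"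
    by blast
qed

end
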